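(* Let $P$ be a poset and $\mathcal C$ a complete and cocomplete category. The assignment $\rho\mapsto d_\rho$, from height-difference functions on $P$ to height-interleaving distances on $\mathrm{Fun}(P,\mathcal C)$, is $1$-Lipschitz with respect to the distortion $\delta$. That is, for any height-difference functions $\rho_1,\rho_2$ on $P$, $$\mathrm{dist}_\infty(d_{\rho_1},d_{\rho_2})\le \delta(\rho_1,\rho_2).$$
   Context: A poset $P$ is regarded as a category (a unique morphism $a\to b$ iff $a\le b$), and $\mathrm{Fun}(P,\mathcal C)$ is the category of functors $P\to\mathcal C$ and natural transformations. All infima of empty sets are $\infty$. A height-difference function on $P$ is a function $\rho:\{(a,b)\in P\times P: a\le b\}\to[0,\infty]$ with $\rho(a,a)=0$ for all $a$ and $\rho(a,c)\ge\rho(a,b)+\rho(b,c)$ whenever $a\le b\le c$. For $a\in P$ and real $r\ge 0$ put $a^{\downarrow_r}=\{x\in P: x\le a,\ \rho(x,a)\ge r\}$ and $a^{\uparrow_r}=\{x\in P: x\ge a,\ \rho(a,x)\ge r\}$ (full subposets). Endofunctors $\mathsf L_r=\mathsf L_r^\rho$ and $\mathsf R_r=\mathsf R_r^\rho$ of $\mathrm{Fun}(P,\mathcal C)$: $(\mathsf L_rM)(a)=\operatorname{colim} M|_{a^{\downarrow_r}}$ and $(\mathsf R_rM)(a)=\lim M|_{a^{\uparrow_r}}$, with structure morphisms for $a\le b$ (using $a^{\downarrow_r}\subseteq b^{\downarrow_r}$, $b^{\uparrow_r}\subseteq a^{\uparrow_r}$) and the action on morphisms induced by the universal properties. Write $\alpha_{a,M}(x):M(x)\to(\mathsf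 L_rM)(a)$ ($x\in a^{\downarrow_r}$) and $\beta_{a,M}(y):(\mathsf R_rM)(a)\to M(y)$ ($y\in a^{\uparrow_r}$) for the canonical maps. The functor $\mathsf L_r$ is left adjoint to $\mathsf R_r$; for $p:M\to\mathsf R_rN$, its adjoint $p^\sharp:\mathsf L_rM\to N$ is the unique morphism with $p^\sharp(a)\circ\alpha_{a,M}(x)=\beta_{x,N}(a)\circ p(x)$ for all $a\in P$, $x\in a^{\downarrow_r}$. Let $\eta^{\mathsf L}_{r,M}:\mathsf L_rM\to M$ and $\eta^{\mathsf R}_{r,M}:M\to\mathsf R_rM$ be induced by the structure maps $M(x\le a)$, $x\in a^{\downarrow_r}$, respectively $M(a\le y)$, $y\in a^{\uparrow_r}$, and set $e_{r,M}=\eta^{\mathsf R}_{r,M}\circ\eta^{\mathsf L}_{r,M}:\mathsf L_rM\to\mathsf R_rM$. $M,N\in\mathrm{Fun}(P,\mathcal C)$ are $r$-height-interleaved with respect to $\rho$ if there are $p:M\to\mathsf R_rN$ and $q:N\to\mathsf R_rM$ with $e_{r,M}=q\circ p^\sharp$ and $e_{r,N}=p\circ q^\sharp$. The height-interleaving distance is $d_\rho(M,N)=\inf\{r\ge0: M,N \text{ are } r\text{-height-interleaved w.r.t. }\rho\}\in[0,\infty]$. For $a,b\in[0,\infty]$ set $|a-b|_\infty=|a-b|$ if $a,b<\infty$, $|a-b|_\infty=0$ if $a=b=\infty$, and $|a-b|_\infty=\infty$ otherwise. Define $\delta(\rho_1,\rho_2)=\inf\{r\ge0: |\rho_1(a,b)-\rho_2(a,b)|_\infty\le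 r\text{ for all }a\le b\}$ and $\mathrm{dist}_\infty(d_{\rho_1},d_{\rho_2})=\inf\{r\ge0: |d_{\rho_1}(M,N)-d_{\rho_2}(M,N)|_\infty\le r\text{ for all }M,N\in\mathrm{Fun}(P,\mathcal C)\}$. *)

theory Defs
  imports Complex_Main "HOL-Library.Extended_Nonnegative_Real" "HOL-Library.FuncSet"
begin

section \<open>Categories, functors, natural transformations\<close>

record ('o, 'm) category =
  Obj :: "'o set"
  Arr :: "'m set"
  Dom :: "'m \<Rightarrow> 'o"
  Cod :: "'m \<Rightarrow> 'o"
  Ident :: "'o \<Rightarrow> 'm"
  Comp :: "'m \<Rightarrow> 'm \<Rightarrow> 'm"  (infixl "\<cdot>\<index>" 70)

definition hom :: "('o, 'm) category \<Rightarrow> 'o \<Rightarrow> 'o \<Rightarrow> 'm set" where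
  "hom C a b = {f \<in> Arr C. Dom C f = a \<and> Cod C f = b}"

definition category :: "('o, 'm) category \<Rightarrow> bool" where
  "category C \<longleftrightarrow>
     (\<forall>f\<in>Arr C. Dom C f \<in> Obj C \<and> Cod C f \<in> Obj C) \<and>
     (\<forall>a\<in>Obj C. Ident C a \<in> hom C a a) \<and>
     (\<forall>f\<in>Arr C. \<forall>g\<in>Arr C. Cod C f = Dom C g \<longrightarrow> g \<cdot>\<^bsub>C\<^esub> f \<in> hom C (Dom C f) (Cod C g)) \<and>
     (\<forall>f\<in>Arr C. Ident C (Cod C f) \<cdot>\<^bsub>C\<^esub> f = f \<and> f \<cdot>\<^bsub>C\<^esub> Ident C (Dom C f) = f) \<and>
     (\<forall>f\<in>Arr C. \<forall>g\<in>Arr C. \<forall>h\<in>Arr C. Cod C f = Dom C g \<longrightarrow> Cod C g = Dom C h \<longrightarrow>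
        (h \<cdot>\<^bsub>C\<^esub> g) \<cdot>\<^bsub>C\<^esub> f = h \<cdot>\<^bsub>C\<^esub> (g \<cdot>\<^bsub>C\<^esub> f))"

record ('i, 'j, 'o, 'm) cat_functor =
  omap :: "'i \<Rightarrow> 'o"
  amap :: "'j \<Rightarrow> 'm"

text \<open>Functors and natural transformations are extensional, i.e. \<^const>\<open>undefined\<close> outside the
  domain, so that equality in HOL is equality of functors and of natural transformations.\<close>

definition Functors ::
    "('i, 'j) category \<Rightarrow> ('o, 'm) category \<Rightarrow> ('i, 'j, 'o, 'm) cat_functor set" where
  "Functors J C = {F.
     omap F \<in> (\<Pi>\<^sub>E a\<in>Obj J. Obj C) \<and>
     amap F \<in> (\<Pi>\<^sub>E f\<in>Arr J. hom C (omap F (Dom J f)) (omap F (Cod J f))) \<and>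
     (\<forall>a\<in>Obj J. amap F (Ident J a) = Ident C (omap F a)) \<and>
     (\<forall>f\<in>Arr J. \<forall>g\<in>Arr J. Cod J f = Dom J g \<longrightarrow>
        amap F (g \<cdot>\<^bsub>J\<^esub> f) = amap F g \<cdot>\<^bsub>C\<^esub> amap F f)}"

definition nat_trans ::
    "('i, 'j) category \<Rightarrow> ('o, 'm) category \<Rightarrow> ('i, 'j, 'o, 'm) cat_functor \<Rightarrow>
     ('i, 'j, 'o, 'm) cat_functor \<Rightarrow> ('i \<Rightarrow> 'm) set" where
  "nat_trans J C F G = {t \<in> (\<Pi>\<^sub>E a\<in>Obj J. hom C (omap F a) (omap G a)).
     \<forall>f\<in>Arr J. t (Cod J f) \<cdot>\<^bsub>C\<^esub> amap F f = amap G f \<cdot>\<^bsub>C\<^esub> t (Dom J f)}"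

definition nt_comp ::
    "('i, 'j) category \<Rightarrow> ('o, 'm) category \<Rightarrow> ('i \<Rightarrow> 'm) \<Rightarrow> ('i \<Rightarrow> 'm) \<Rightarrow> 'i \<Rightarrow> 'm" where
  "nt_comp J C s t = (\<lambda>a\<in>Obj J. s a \<cdot>\<^bsub>C\<^esub> t a)"


section \<open>Limits and colimits\<close>

definition is_cone ::
    "('i, 'j) category \<Rightarrow> ('o, 'm) category \<Rightarrow> ('i, 'j, 'o, 'm) cat_functor \<Rightarrow> 'o \<Rightarrow>
     ('i \<Rightarrow> 'm) \<Rightarrow> bool" where
  "is_cone J C D c \<pi> \<longleftrightarrow> c \<in> Obj C \<and> \<pi> \<in> (\<Pi>\<^sub>E a\<in>Obj J. hom C c (omap D a)) \<and>
     (\<forall>f\<in>Arr J. amap D f \<cdot>\<^bsub>C\<^esub> \<pi> (Dom J f) = \<pi> (Cod J f))"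

definition is_limit ::
    "('i, 'j) category \<Rightarrow> ('o, 'm) category \<Rightarrow> ('i, 'j, 'o, 'm) cat_functor \<Rightarrow> 'o \<Rightarrow>
     ('i \<Rightarrow> 'm) \<Rightarrow> bool" where
  "is_limit J C D c \<pi> \<longleftrightarrow> is_cone J C D c \<pi> \<and>
     (\<forall>c' \<pi>'. is_cone J C D c' \<pi>' \<longrightarrow>
        (\<exists>!u. u \<in> hom C c' c \<and> (\<forall>a\<in>Obj J. \<pi> a \<cdot>\<^bsub>C\<^esub> u = \<pi>' a)))"

definition is_cocone ::
    "('i, 'j) category \<Rightarrow> ('o, 'm) category \<Rightarrow> ('i, 'j, 'o, 'm) cat_functor \<Rightarrow> 'o \<Rightarrow>
     ('i \<Rightarrow> 'm) \<Rightarrow> bool" where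
  "is_cocone J C D c \<iota> \<longleftrightarrow> c \<in> Obj C \<and> \<iota> \<in> (\<Pi>\<^sub>E a\<in>Obj J. hom C (omap D a) c) \<and>
     (\<forall>f\<in>Arr J. \<iota> (Cod J f) \<cdot>\<^bsub>C\<^esub> amap D f = \<iota> (Dom J f))"

definition is_colimit ::
    "('i, 'j) category \<Rightarrow> ('o, 'm) category \<Rightarrow> ('i, 'j, 'o, 'm) cat_functor \<Rightarrow> 'o \<Rightarrow>
     ('i \<Rightarrow> 'm) \<Rightarrow> bool" where
  "is_colimit J C D c \<iota> \<longleftrightarrow> is_cocone J C D c \<iota> \<and>
     (\<forall>c' \<iota>'. is_cocone J C D c' \<iota>' \<longrightarrow>
        (\<exists>!u. u \<in> hom C c c' \<and> (\<forall>a\<in>Obj J. u \<cdot>\<^bsub>C\<^esub> \<iota> a = \<iota>' a)))"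

text \<open>Smallness is expressed by types: the small categories are those whose objects lie in the
  type \<open>'i\<close> and whose arrows lie in the type \<open>'j\<close>, whereas the types of objects and arrows of the
  category \<open>C\<close> itself are arbitrary. For a poset on a subset of \<open>'p\<close>, the relevant universe is
  \<open>'i = 'p\<close>, \<open>'j = 'p \<times> 'p\<close>; having all limits of these shapes is implied by having all limits
  over any larger universe.\<close>

definition complete_category ::
    "('i, 'j) category itself \<Rightarrow> ('o, 'm) category \<Rightarrow> bool" where
  "complete_category _ C \<longleftrightarrow>
     (\<forall>J :: ('i, 'j) category. category J \<longrightarrow> (\<forall>D\<in>Functors J C. \<exists>c \<pi>. is_limit J C D c \<pi>))"

definition cocomplete_category ::
    "('i, 'j) category itself \<Rightarrow> ('o, 'm) category \<Rightarrow> bool" where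
  "cocomplete_category _ C \<longleftrightarrow>
     (\<forall>J :: ('i, 'j) category. category J \<longrightarrow> (\<forall>D\<in>Functors J C. \<exists>c \<iota>. is_colimit J C D c \<iota>))"

text \<open>A choice of (co)limits; any two choices are canonically isomorphic.\<close>

definition chosen_limit ::
    "('i, 'j) category \<Rightarrow> ('o, 'm) category \<Rightarrow> ('i, 'j, 'o, 'm) cat_functor \<Rightarrow> 'o \<times> ('i \<Rightarrow> 'm)" where
  "chosen_limit J C D = (SOME (c, \<pi>). is_limit J C D c \<pi>)"

definition chosen_colimit ::
    "('i, 'j) category \<Rightarrow> ('o, 'm) category \<Rightarrow> ('i, 'j, 'o, 'm) cat_functor \<Rightarrow> 'o \<times> ('i \<Rightarrow> 'm)" where
  "chosen_colimit J C D = (SOME (c, \<iota>). is_colimit J C D c \<iota>)"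


section \<open>Posets as categories\<close>

text \<open>The morphism \<open>a \<rightarrow> b\<close> is the pair \<open>(a, b)\<close>, where \<open>(a, b) \<in> le\<close> means \<open>a \<le> b\<close>. For
  \<open>S \<subseteq> P\<close>, the full subposet of \<open>(P, le)\<close> on \<open>S\<close> is \<open>poset_cat S le\<close>.\<close>

definition poset_cat :: "'p set \<Rightarrow> 'p rel \<Rightarrow> ('p, 'p \<times> 'p) category" where
  "poset_cat P le = \<lparr>Obj = P, Arr = le \<inter> P \<times> P, Dom = fst, Cod = snd,
     Ident = (\<lambda>a. (a, a)), Comp = (\<lambda>g f. (fst f, snd g))\<rparr>"

type_synonym ('p, 'o, 'm) pfunctor = "('p, 'p \<times> 'p, 'o, 'm) cat_functor"

definition restrict_functor ::
    "'p set \<Rightarrow> 'p rel \<Rightarrow> ('p, 'o, 'm) pfunctor \<Rightarrow> ('p, 'o, 'm) pfunctor" where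
  "restrict_functor S le M =
     \<lparr>omap = restrict (omap M) S, amap = restrict (amap M) (le \<inter> S \<times> S)\<rparr>"


section \<open>Height-difference functions and the functors L and R\<close>

definition height_difference :: "'p set \<Rightarrow> 'p rel \<Rightarrow> ('p \<Rightarrow> 'p \<Rightarrow> ennreal) \<Rightarrow> bool" where
  "height_difference P le \<rho> \<longleftrightarrow> (\<forall>a\<in>P. \<rho> a a = 0) \<and>
     (\<forall>a\<in>P. \<forall>b\<in>P. \<forall>c\<in>P. (a, b) \<in> le \<longrightarrow> (b, c) \<in> le \<longrightarrow> \<rho> a c \<ge> \<rho> a b + \<rho> b c)"

definition down ::
    "'p set \<Rightarrow> 'p rel \<Rightarrow> ('p \<Rightarrow> 'p \<Rightarrow> ennreal) \<Rightarrow> real \<Rightarrow> 'p \<Rightarrow> 'p set" where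
  "down P le \<rho> r a = {x \<in> P. (x, a) \<in> le \<and> \<rho> x a \<ge> ennreal r}"

definition up ::
    "'p set \<Rightarrow> 'p rel \<Rightarrow> ('p \<Rightarrow> 'p \<Rightarrow> ennreal) \<Rightarrow> real \<Rightarrow> 'p \<Rightarrow> 'p set" where
  "up P le \<rho> r a = {x \<in> P. (a, x) \<in> le \<and> \<rho> a x \<ge> ennreal r}"

definition L_obj ::
    "'p set \<Rightarrow> 'p rel \<Rightarrow> ('o, 'm) category \<Rightarrow> ('p \<Rightarrow> 'p \<Rightarrow> ennreal) \<Rightarrow> real \<Rightarrow>
     ('p, 'o, 'm) pfunctor \<Rightarrow> 'p \<Rightarrow> 'o" where
  "L_obj P le C \<rho> r M a =
     (let S = down P le \<rho> r a in fst (chosen_colimit (poset_cat S le) C (restrict_functor S le M)))"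

definition alpha ::
    "'p set \<Rightarrow> 'p rel \<Rightarrow> ('o, 'm) category \<Rightarrow> ('p \<Rightarrow> 'p \<Rightarrow> ennreal) \<Rightarrow> real \<Rightarrow>
     ('p, 'o, 'm) pfunctor \<Rightarrow> 'p \<Rightarrow> 'p \<Rightarrow> 'm" where
  "alpha P le C \<rho> r M a =
     (let S = down P le \<rho> r a in snd (chosen_colimit (poset_cat S le) C (restrict_functor S le M)))"

definition R_obj ::
    "'p set \<Rightarrow> 'p rel \<Rightarrow> ('o, 'm) category \<Rightarrow> ('p \<Rightarrow> 'p \<Rightarrow> ennreal) \<Rightarrow> real \<Rightarrow>
     ('p, 'o, 'm) pfunctor \<Rightarrow> 'p \<Rightarrow> 'o" where
  "R_obj P le C \<rho> r M a =
     (let S = up P le \<rho> r a in fst (chosen_limit (poset_cat S le) C (restrict_functor S le M)))"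

definition beta ::
    "'p set \<Rightarrow> 'p rel \<Rightarrow> ('o, 'm) category \<Rightarrow> ('p \<Rightarrow> 'p \<Rightarrow> ennreal) \<Rightarrow> real \<Rightarrow>
     ('p, 'o, 'm) pfunctor \<Rightarrow> 'p \<Rightarrow> 'p \<Rightarrow> 'm" where
  "beta P le C \<rho> r M a =
     (let S = up P le \<rho> r a in snd (chosen_limit (poset_cat S le) C (restrict_functor S le M)))"

definition L_fun ::
    "'p set \<Rightarrow> 'p rel \<Rightarrow> ('o, 'm) category \<Rightarrow> ('p \<Rightarrow> 'p \<Rightarrow> ennreal) \<Rightarrow> real \<Rightarrow>
     ('p, 'o, 'm) pfunctor \<Rightarrow> ('p, 'o, 'm) pfunctor" where
  "L_fun P le C \<rho> r M = \<lparr>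
     omap = (\<lambda>a\<in>P. L_obj P le C \<rho> r M a),
     amap = restrict (\<lambda>(a, b). THE u.
       u \<in> hom C (L_obj P le C \<rho> r M a) (L_obj P le C \<rho> r M b) \<and>
       (\<forall>x\<in>down P le \<rho> r a. u \<cdot>\<^bsub>C\<^esub> alpha P le C \<rho> r M a x = alpha P le C \<rho> r M b x)) (le \<inter> P \<times> P)\<rparr>"

definition R_fun ::
    "'p set \<Rightarrow> 'p rel \<Rightarrow> ('o, 'm) category \<Rightarrow> ('p \<Rightarrow> 'p \<Rightarrow> ennreal) \<Rightarrow> real \<Rightarrow>
     ('p, 'o, 'm) pfunctor \<Rightarrow> ('p, 'o, 'm) pfunctor" where
  "R_fun P le C \<rho> r M = \<lparr>
     omap = (\<lambda>a\<in>P. R_obj P le C \<rho> r M a),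
     amap = restrict (\<lambda>(a, b). THE u.
       u \<in> hom C (R_obj P le C \<rho> r M a) (R_obj P le C \<rho> r M b) \<and>
       (\<forall>y\<in>up P le \<rho> r b. beta P le C \<rho> r M b y \<cdot>\<^bsub>C\<^esub> u = beta P le C \<rho> r M a y)) (le \<inter> P \<times> P)\<rparr>"

text \<open>The adjoint \<open>L M \<rightarrow> N\<close> of \<open>p : M \<rightarrow> R N\<close>.\<close>

definition sharp ::
    "'p set \<Rightarrow> 'p rel \<Rightarrow> ('o, 'm) category \<Rightarrow> ('p \<Rightarrow> 'p \<Rightarrow> ennreal) \<Rightarrow> real \<Rightarrow>
     ('p, 'o, 'm) pfunctor \<Rightarrow> ('p, 'o, 'm) pfunctor \<Rightarrow> ('p \<Rightarrow> 'm) \<Rightarrow> 'p \<Rightarrow> 'm" where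
  "sharp P le C \<rho> r M N p = (THE t.
     t \<in> nat_trans (poset_cat P le) C (L_fun P le C \<rho> r M) N \<and>
     (\<forall>a\<in>P. \<forall>x\<in>down P le \<rho> r a.
        t a \<cdot>\<^bsub>C\<^esub> alpha P le C \<rho> r M a x = beta P le C \<rho> r N x a \<cdot>\<^bsub>C\<^esub> p x))"

definition eta_L ::
    "'p set \<Rightarrow> 'p rel \<Rightarrow> ('o, 'm) category \<Rightarrow> ('p \<Rightarrow> 'p \<Rightarrow> ennreal) \<Rightarrow> real \<Rightarrow>
     ('p, 'o, 'm) pfunctor \<Rightarrow> 'p \<Rightarrow> 'm" where
  "eta_L P le C \<rho> r M = (\<lambda>a\<in>P. THE u. u \<in> hom C (L_obj P le C \<rho> r M a) (omap M a) \<and>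
     (\<forall>x\<in>down P le \<rho> r a. u \<cdot>\<^bsub>C\<^esub> alpha P le C \<rho> r M a x = amap M (x, a)))"

definition eta_R ::
    "'p set \<Rightarrow> 'p rel \<Rightarrow> ('o, 'm) category \<Rightarrow> ('p \<Rightarrow> 'p \<Rightarrow> ennreal) \<Rightarrow> real \<Rightarrow>
     ('p, 'o, 'm) pfunctor \<Rightarrow> 'p \<Rightarrow> 'm" where
  "eta_R P le C \<rho> r M = (\<lambda>a\<in>P. THE u. u \<in> hom C (omap M a) (R_obj P le C \<rho> r M a) \<and>
     (\<forall>y\<in>up P le \<rho> r a. beta P le C \<rho> r M a y \<cdot>\<^bsub>C\<^esub> u = amap M (a, y)))"

definition e_map ::
    "'p set \<Rightarrow> 'p rel \<Rightarrow> ('o, 'm) category \<Rightarrow> ('p \<Rightarrow> 'p \<Rightarrow> ennreal) \<Rightarrow> real \<Rightarrow>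
     ('p, 'o, 'm) pfunctor \<Rightarrow> 'p \<Rightarrow> 'm" where
  "e_map P le C \<rho> r M = nt_comp (poset_cat P le) C (eta_R P le C \<rho> r M) (eta_L P le C \<rho> r M)"


section \<open>Interleavings and distances\<close>

definition height_interleaved ::
    "'p set \<Rightarrow> 'p rel \<Rightarrow> ('o, 'm) category \<Rightarrow> ('p \<Rightarrow> 'p \<Rightarrow> ennreal) \<Rightarrow> real \<Rightarrow>
     ('p, 'o, 'm) pfunctor \<Rightarrow> ('p, 'o, 'm) pfunctor \<Rightarrow> bool" where
  "height_interleaved P le C \<rho> r M N \<longleftrightarrow>
     (\<exists>p\<in>nat_trans (poset_cat P le) C M (R_fun P le C \<rho> r N).
      \<exists>q\<in>nat_trans (poset_cat P le) C N (R_fun P le C \<rho> r M).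
        e_map P le C \<rho> r M = nt_comp (poset_cat P le) C q (sharp P le C \<rho> r M N p) \<and>
        e_map P le C \<rho> r N = nt_comp (poset_cat P le) C p (sharp P le C \<rho> r N M q))"

definition height_dist ::
    "'p set \<Rightarrow> 'p rel \<Rightarrow> ('o, 'm) category \<Rightarrow> ('p \<Rightarrow> 'p \<Rightarrow> ennreal) \<Rightarrow>
     ('p, 'o, 'm) pfunctor \<Rightarrow> ('p, 'o, 'm) pfunctor \<Rightarrow> ennreal" where
  "height_dist P le C \<rho> M N = Inf {ennreal r | r. r \<ge> 0 \<and> height_interleaved P le C \<rho> r M N}"

text \<open>Subtraction on \<^typ>\<open>ennreal\<close> is truncated, hence the detour through \<^typ>\<open>real\<close>.\<close>

definition absdiff_infty :: "ennreal \<Rightarrow> ennreal \<Rightarrow> ennreal" where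
  "absdiff_infty a b =
     (if a < \<infinity> \<and> b < \<infinity> then ennreal \<bar>enn2real a - enn2real b\<bar>
      else if a = \<infinity> \<and> b = \<infinity> then 0 else \<infinity>)"

definition distortion ::
    "'p set \<Rightarrow> 'p rel \<Rightarrow> ('p \<Rightarrow> 'p \<Rightarrow> ennreal) \<Rightarrow> ('p \<Rightarrow> 'p \<Rightarrow> ennreal) \<Rightarrow> ennreal" where
  "distortion P le \<rho>1 \<rho>2 = Inf {ennreal r | r. r \<ge> 0 \<and>
     (\<forall>a\<in>P. \<forall>b\<in>P. (a, b) \<in> le \<longrightarrow> absdiff_infty (\<rho>1 a b) (\<rho>2 a b) \<le> ennreal r)}"

definition dist_infty :: "'x set \<Rightarrow> ('x \<Rightarrow> 'x \<Rightarrow> ennreal) \<Rightarrow> ('x \<Rightarrow> 'x \<Rightarrow> ennreal) \<Rightarrow> ennreal" where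
  "dist_infty X d1 d2 = Inf {ennreal r | r. r \<ge> 0 \<and>
     (\<forall>M\<in>X. \<forall>N\<in>X. absdiff_infty (d1 M N) (d2 M N) \<le> ennreal r)}"

end

theory Submission
  imports Defs
begin

text \<open>By the universal properties, a morphism \<open>p : M \<rightarrow> R\<^sub>r N\<close> is the same as a family of morphisms
  \<open>M(a) \<rightarrow> N(b)\<close>, indexed by the pairs \<open>a \<le> b\<close> of height difference at least \<open>r\<close> and natural in
  both variables. In these terms \<open>e = q \<circ> p\<^sup>\<sharp>\<close> says that for \<open>x \<le> a \<le> y\<close> the composite
  \<open>M(x) \<rightarrow> N(a) \<rightarrow> M(y)\<close> is the structure map of \<open>M\<close>. If two height-difference functions differ by
  at most \<open>s\<close>, then the pairs of \<open>\<rho>\<^sub>2\<close>-height at least \<open>r + s\<close> are among those of \<open>\<rho>\<^sub>1\<close>-height at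
  least \<open>r\<close>, so restricting the families turns an \<open>r\<close>-interleaving for \<open>\<rho>\<^sub>1\<close> into an
  \<open>(r + s)\<close>-interleaving for \<open>\<rho>\<^sub>2\<close>.\<close>

section \<open>Composition, posets as categories, and chosen limits and colimits\<close>

lemma comp_in_hom:
  assumes "category C" "f \<in> hom C a b" "g \<in> hom C b c"
  shows "g \<cdot>\<^bsub>C\<^esub> f \<in> hom C a c"
  using assms unfolding category_def hom_def by auto

lemma comp_assoc:
  assumes "category C" "f \<in> hom C a b" "g \<in> hom C b c" "h \<in> hom C c d"
  shows "(h \<cdot>\<^bsub>C\<^esub> g) \<cdot>\<^bsub>C\<^esub> f = h \<cdot>\<^bsub>C\<^esub> (g \<cdot>\<^bsub>C\<^esub> f)"
  using assms unfolding category_def hom_def by auto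

lemma poset_cat_simps [simp]:
  "Obj (poset_cat P le) = P" "Arr (poset_cat P le) = le \<inter> P \<times> P"
  "Dom (poset_cat P le) = fst" "Cod (poset_cat P le) = snd"
  "Ident (poset_cat P le) a = (a, a)" "g \<cdot>\<^bsub>poset_cat P le\<^esub> f = (fst f, snd g)"
  by (simp_all add: poset_cat_def)

lemma is_colimit_chosen:
  assumes "\<exists>c \<iota>. is_colimit J C D c \<iota>"
  shows "is_colimit J C D (fst (chosen_colimit J C D)) (snd (chosen_colimit J C D))"
proof -
  \<comment> \<open>The choice is a \<open>SOME\<close> over pairs with a case abstraction. Naming
    the predicate lets \<open>someI_ex\<close> apply to the pair as a whole before it is split into
    components.\<close>
  define Q where "Q = (\<lambda>(c, \<iota>). is_colimit J C D c \<iota>)"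
  have "\<exists>z. Q z"
    using assms by (auto simp: Q_def)
  then have "Q (SOME z. Q z)"
    by (rule someI_ex)
  then have "Q (chosen_colimit J C D)"
    unfolding chosen_colimit_def Q_def .
  then show ?thesis
    by (simp add: Q_def case_prod_beta)
qed

lemma is_limit_chosen:
  assumes "\<exists>c \<pi>. is_limit J C D c \<pi>"
  shows "is_limit J C D (fst (chosen_limit J C D)) (snd (chosen_limit J C D))"
proof -
  define Q where "Q = (\<lambda>(c, \<pi>). is_limit J C D c \<pi>)"
  have "\<exists>z. Q z"
    using assms by (auto simp: Q_def)
  then have "Q (SOME z. Q z)"
    by (rule someI_ex)
  then have "Q (chosen_limit J C D)"
    unfolding chosen_limit_def Q_def .
  then show ?thesis
    by (simp add: Q_def case_prod_beta)
qed

section \<open>Functors and natural transformations on a fixed poset\<close>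

locale poset_functors =
  fixes P :: "'p set" and le :: "'p rel" and C :: "('o, 'm) category"
  assumes po: "partial_order_on P le"
    and cat: "category C"
    and complete: "complete_category TYPE(('p, 'p \<times> 'p) category) C"
    and cocomplete: "cocomplete_category TYPE(('p, 'p \<times> 'p) category) C"
begin

abbreviation Fun :: "('p, 'o, 'm) pfunctor set" where
  "Fun \<equiv> Functors (poset_cat P le) C"

lemma le_refl: "a \<in> P \<Longrightarrow> (a, a) \<in> le"
  using po by (auto simp: partial_order_on_def preorder_on_def refl_on_def)

lemma le_trans: "(a, b) \<in> le \<Longrightarrow> (b, c) \<in> le \<Longrightarrow> (a, c) \<in> le"
  using po by (auto simp: partial_order_on_def preorder_on_def dest: transD)

lemma le_in: assumes "(a, b) \<in> le" shows "a \<in> P" "b \<in> P"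
  using assms po by (auto simp: partial_order_on_def preorder_on_def)

lemma category_poset_cat: "S \<subseteq> P \<Longrightarrow> category (poset_cat S le)"
  by (auto simp: category_def hom_def intro: le_refl le_trans)

lemma hom_in: "f \<in> hom C a b \<Longrightarrow> a \<in> Obj C \<and> b \<in> Obj C"
  using cat by (auto simp: category_def hom_def)

lemma omap_in: "M \<in> Fun \<Longrightarrow> a \<in> P \<Longrightarrow> omap M a \<in> Obj C"
  by (auto simp: Functors_def)

lemma amap_in:
  assumes "M \<in> Fun" "(a, b) \<in> le"
  shows "amap M (a, b) \<in> hom C (omap M a) (omap M b)"
proof -
  have M: "amap M \<in> (\<Pi>\<^sub>E f\<in>le \<inter> P \<times> P. hom C (omap M (fst f)) (omap M (snd f)))"
    using assms(1) by (simp add: Functors_def)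
  have "(a, b) \<in> le \<inter> P \<times> P"
    using assms(2) le_in by blast
  from PiE_mem[OF M this] show ?thesis
    by simp
qed

lemma amap_comp:
  assumes "M \<in> Fun" "(a, b) \<in> le" "(b, c) \<in> le"
  shows "amap M (b, c) \<cdot>\<^bsub>C\<^esub> amap M (a, b) = amap M (a, c)"
proof -
  have "\<forall>f\<in>le \<inter> P \<times> P. \<forall>g\<in>le \<inter> P \<times> P. snd f = fst g \<longrightarrow>
      amap M (fst f, snd g) = amap M g \<cdot>\<^bsub>C\<^esub> amap M f"
    using assms(1) by (simp add: Functors_def)
  moreover have "(a, b) \<in> le \<inter> P \<times> P" "(b, c) \<in> le \<inter> P \<times> P"
    using assms le_in by blast+
  ultimately have "amap M (fst (a, b), snd (b, c)) = amap M (b, c) \<cdot>\<^bsub>C\<^esub> amap M (a, b)"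
    by (metis fst_conv snd_conv)
  then show ?thesis
    by simp
qed

lemma restrict_functor_in:
  assumes M: "M \<in> Fun" and S: "S \<subseteq> P"
  shows "restrict_functor S le M \<in> Functors (poset_cat S le) C"
proof -
  have "amap M (a, a) = Ident C (omap M a)" if "a \<in> P" for a
    using M that by (simp add: Functors_def)
  then show ?thesis
    using S amap_in[OF M] amap_comp[OF M] omap_in[OF M]
    by (auto simp: Functors_def restrict_functor_def le_refl le_trans)
qed

lemma natural:
  assumes "t \<in> nat_trans (poset_cat P le) C F G"
  shows "a \<in> P \<Longrightarrow> t a \<in> hom C (omap F a) (omap G a)"
    and "(a, b) \<in> le \<Longrightarrow> t b \<cdot>\<^bsub>C\<^esub> amap F (a, b) = amap G (a, b) \<cdot>\<^bsub>C\<^esub> t a"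
proof -
  show "t a \<in> hom C (omap F a) (omap G a)" if "a \<in> P"
    using assms that by (auto simp: nat_trans_def)
  show "t b \<cdot>\<^bsub>C\<^esub> amap F (a, b) = amap G (a, b) \<cdot>\<^bsub>C\<^esub> t a" if "(a, b) \<in> le"
  proof -
    have "(a, b) \<in> le \<inter> P \<times> P"
      using that le_in by blast
    then show ?thesis
      using assms by (force simp: nat_trans_def)
  qed
qed

lemma nat_transI:
  assumes "t \<in> extensional P"
    and "\<And>a. a \<in> P \<Longrightarrow> t a \<in> hom C (omap F a) (omap G a)"
    and "\<And>a b. (a, b) \<in> le \<Longrightarrow> t b \<cdot>\<^bsub>C\<^esub> amap F (a, b) = amap G (a, b) \<cdot>\<^bsub>C\<^esub> t a"
  shows "t \<in> nat_trans (poset_cat P le) C F G"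
  using assms by (auto simp: nat_trans_def PiE_def)

end

section \<open>Pairs of large height difference\<close>

locale height_poset_functors = poset_functors P le C
  for P :: "'p set" and le :: "'p rel" and C :: "('o, 'm) category" +
  fixes \<rho> :: "'p \<Rightarrow> 'p \<Rightarrow> ennreal" and r :: real
  assumes height: "height_difference P le \<rho>"
begin

text \<open>Both kinds of index set are slices of this one relation: fixing the upper entry gives a
  down-set, fixing the lower entry an up-set. Hence the constructions for \<open>L\<close> and
  \<open>R\<close> can be phrased in the same terms.\<close>

definition far :: "'p rel" where
  "far = {(a, b) \<in> le. \<rho> a b \<ge> ennreal r}"

lemma far_le: "(a, b) \<in> far \<Longrightarrow> (a, b) \<in> le"
  by (simp add: far_def)

lemma far_in: assumes "(a, b) \<in> far" shows "a \<in> P" "b \<in> P"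
  using assms far_le le_in by blast+

lemma down_iff: "x \<in> down P le \<rho> r a \<longleftrightarrow> (x, a) \<in> far"
  by (auto simp: down_def far_def dest: le_in)

lemma up_iff: "y \<in> up P le \<rho> r a \<longleftrightarrow> (a, y) \<in> far"
  by (auto simp: up_def far_def dest: le_in)

lemma height_add_le:
  assumes "(a, b) \<in> le" "(b, c) \<in> le"
  shows "\<rho> a b + \<rho> b c \<le> \<rho> a c"
  using height assms le_in[OF assms(1)] le_in[OF assms(2)]
  unfolding height_difference_def by blast

text \<open>By superadditivity and nonnegativity, enlarging an interval never decreases its height
  difference. Together with \<open>far_trans2\<close>, the relation \<open>far\<close> absorbs
  \<open>le\<close> on both sides. So the index sets are down-closed and up-closed respectively, and
  they grow or shrink monotonically with the base point.\<close>

lemma far_trans1: assumes "(a, b) \<in> le" "(b, c) \<in> far" shows "(a, c) \<in> far"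
proof -
  have bc: "(b, c) \<in> le" and "ennreal r \<le> \<rho> b c"
    using assms(2) by (simp_all add: far_def)
  then have "ennreal r \<le> \<rho> a b + \<rho> b c"
    by (simp add: add_increasing)
  also have "\<dots> \<le> \<rho> a c"
    by (rule height_add_le[OF assms(1) bc])
  finally show ?thesis
    using le_trans[OF assms(1) bc] by (simp add: far_def)
qed

lemma far_trans2: assumes "(a, b) \<in> far" "(b, c) \<in> le" shows "(a, c) \<in> far"
proof -
  have ab: "(a, b) \<in> le" and "ennreal r \<le> \<rho> a b"
    using assms(1) by (simp_all add: far_def)
  then have "ennreal r \<le> \<rho> a b + \<rho> b c"
    by (simp add: add_increasing2)
  also have "\<dots> \<le> \<rho> a c"
    by (rule height_add_le[OF ab assms(2)])
  finally show ?thesis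
    using le_trans[OF ab assms(2)] by (simp add: far_def)
qed

abbreviation "L \<equiv> L_fun P le C \<rho> r"
abbreviation "R \<equiv> R_fun P le C \<rho> r"
abbreviation "Lo \<equiv> L_obj P le C \<rho> r"
abbreviation "Ro \<equiv> R_obj P le C \<rho> r"
abbreviation "\<alpha> \<equiv> alpha P le C \<rho> r"
abbreviation "\<beta> \<equiv> beta P le C \<rho> r"

section \<open>Colimits over down-sets and limits over up-sets\<close>

lemma alpha_colimit:
  assumes M: "M \<in> Fun"
  defines "S \<equiv> down P le \<rho> r"
  shows "is_colimit (poset_cat (S a) le) C (restrict_functor (S a) le M) (Lo M a) (\<alpha> M a)"
proof -
  have S: "S a \<subseteq> P"
    by (auto simp: S_def down_def)
  \<comment> \<open>The index category is the full subposet on \<open>S a\<close>. Its objects and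
    arrows live in the types at which the locale assumes cocompleteness.\<close>
  have "\<exists>c \<iota>. is_colimit (poset_cat (S a) le) C (restrict_functor (S a) le M) c \<iota>"
    using cocomplete category_poset_cat[OF S] restrict_functor_in[OF M S]
    by (auto simp: cocomplete_category_def)
  then show ?thesis
    unfolding L_obj_def alpha_def Let_def S_def by (rule is_colimit_chosen)
qed

lemma beta_limit:
  assumes M: "M \<in> Fun"
  defines "S \<equiv> up P le \<rho> r"
  shows "is_limit (poset_cat (S a) le) C (restrict_functor (S a) le M) (Ro M a) (\<beta> M a)"
proof -
  have S: "S a \<subseteq> P"
    by (auto simp: S_def up_def)
  have "\<exists>c \<pi>. is_limit (poset_cat (S a) le) C (restrict_functor (S a) le M) c \<pi>"
    using complete category_poset_cat[OF S] restrict_functor_in[OF M S]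
    by (auto simp: complete_category_def)
  then show ?thesis
    unfolding R_obj_def beta_def Let_def S_def by (rule is_limit_chosen)
qed

lemma
  assumes M: "M \<in> Fun"
  shows Lo_in: "Lo M a \<in> Obj C"
    and alpha_in: "(x, a) \<in> far \<Longrightarrow> \<alpha> M a x \<in> hom C (omap M x) (Lo M a)"
    and alpha_comp: "(x, y) \<in> le \<Longrightarrow> (y, a) \<in> far \<Longrightarrow> \<alpha> M a y \<cdot>\<^bsub>C\<^esub> amap M (x, y) = \<alpha> M a x"
proof -
  define S where "S = down P le \<rho> r a"
  have c: "is_cocone (poset_cat S le) C (restrict_functor S le M) (Lo M a) (\<alpha> M a)"
    using alpha_colimit[OF M] by (simp add: is_colimit_def S_def)
  show "Lo M a \<in> Obj C"
    using c by (simp add: is_cocone_def)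
  show "\<alpha> M a x \<in> hom C (omap M x) (Lo M a)" if "(x, a) \<in> far"
  proof -
    have "x \<in> S"
      using that by (simp add: S_def down_iff)
    then show ?thesis
      using c by (auto simp: is_cocone_def restrict_functor_def dest: PiE_mem)
  qed
  show "\<alpha> M a y \<cdot>\<^bsub>C\<^esub> amap M (x, y) = \<alpha> M a x" if "(x, y) \<in> le" "(y, a) \<in> far"
  proof -
    \<comment> \<open>Down-closure of the index set puts \<open>x\<close> into it, so
      \<open>(x, y)\<close> is an arrow of the index category.\<close>
    have "(x, y) \<in> le \<inter> S \<times> S"
      using that far_trans1 by (auto simp: S_def down_iff)
    then show ?thesis
      using c by (force simp: is_cocone_def restrict_functor_def)
  qed
qed

lemma
  assumes M: "M \<in> Fun"
  shows Ro_in: "Ro M a \<in> Obj C"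
    and beta_in: "(a, y) \<in> far \<Longrightarrow> \<beta> M a y \<in> hom C (Ro M a) (omap M y)"
    and beta_comp: "(a, x) \<in> far \<Longrightarrow> (x, y) \<in> le \<Longrightarrow> amap M (x, y) \<cdot>\<^bsub>C\<^esub> \<beta> M a x = \<beta> M a y"
proof -
  define S where "S = up P le \<rho> r a"
  have c: "is_cone (poset_cat S le) C (restrict_functor S le M) (Ro M a) (\<beta> M a)"
    using beta_limit[OF M] by (simp add: is_limit_def S_def)
  show "Ro M a \<in> Obj C"
    using c by (simp add: is_cone_def)
  show "\<beta> M a y \<in> hom C (Ro M a) (omap M y)" if "(a, y) \<in> far"
  proof -
    have "y \<in> S"
      using that by (simp add: S_def up_iff)
    then show ?thesis
      using c by (auto simp: is_cone_def restrict_functor_def dest: PiE_mem)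
  qed
  show "amap M (x, y) \<cdot>\<^bsub>C\<^esub> \<beta> M a x = \<beta> M a y" if "(a, x) \<in> far" "(x, y) \<in> le"
  proof -
    have "(x, y) \<in> le \<inter> S \<times> S"
      using that far_trans2 by (auto simp: S_def up_iff)
    then show ?thesis
      using c by (force simp: is_cone_def restrict_functor_def)
  qed
qed

text \<open>The universal property of the colimit, freed from the restricted functor; the maps out
  of \<open>Lo M a\<close> are obtained from it. The conclusion speaks of \<open>down\<close> rather
  than \<open>far\<close> to match the \<open>THE\<close> descriptions in \<open>L_fun\<close> and
  \<open>eta_L\<close>.\<close>

lemma Lo_universal:
  assumes M: "M \<in> Fun" and c: "c \<in> Obj C"
    and g: "\<And>x. (x, a) \<in> far \<Longrightarrow> g x \<in> hom C (omap M x) c"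
    and g_comp: "\<And>x y. (x, y) \<in> le \<Longrightarrow> (y, a) \<in> far \<Longrightarrow> g y \<cdot>\<^bsub>C\<^esub> amap M (x, y) = g x"
  shows "\<exists>!u. u \<in> hom C (Lo M a) c \<and> (\<forall>x\<in>down P le \<rho> r a. u \<cdot>\<^bsub>C\<^esub> \<alpha> M a x = g x)"
proof -
  define S where "S = down P le \<rho> r a"
  \<comment> \<open>Cocones are extensional, whereas \<open>g\<close> is arbitrary off the index
    set; hence the restriction.\<close>
  have "is_cocone (poset_cat S le) C (restrict_functor S le M) c (restrict g S)"
    using c g g_comp by (auto simp: is_cocone_def restrict_functor_def S_def down_iff)
  moreover have "\<exists>!u. u \<in> hom C (Lo M a) c' \<and> (\<forall>x\<in>S. u \<cdot>\<^bsub>C\<^esub> \<alpha> M a x = g' x)"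
    if "is_cocone (poset_cat S le) C (restrict_functor S le M) c' g'" for c' g'
    using alpha_colimit[OF M, of a] that by (simp add: is_colimit_def S_def)
  ultimately have "\<exists>!u. u \<in> hom C (Lo M a) c \<and> (\<forall>x\<in>S. u \<cdot>\<^bsub>C\<^esub> \<alpha> M a x = restrict g S x)"
    by blast
  then show ?thesis
    by (simp add: S_def)
qed

lemma Ro_universal:
  assumes M: "M \<in> Fun" and c: "c \<in> Obj C"
    and g: "\<And>y. (a, y) \<in> far \<Longrightarrow> g y \<in> hom C c (omap M y)"
    and g_comp: "\<And>x y. (a, x) \<in> far \<Longrightarrow> (x, y) \<in> le \<Longrightarrow> amap M (x, y) \<cdot>\<^bsub>C\<^esub> g x = g y"
  shows "\<exists>!u. u \<in> hom C c (Ro M a) \<and> (\<forall>y\<in>up P le \<rho> r a. \<beta> M a y \<cdot>\<^bsub>C\<^esub> u = g y)"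
proof -
  define S where "S = up P le \<rho> r a"
  have "is_cone (poset_cat S le) C (restrict_functor S le M) c (restrict g S)"
    using c g g_comp by (auto simp: is_cone_def restrict_functor_def S_def up_iff)
  moreover have "\<exists>!u. u \<in> hom C c' (Ro M a) \<and> (\<forall>y\<in>S. \<beta> M a y \<cdot>\<^bsub>C\<^esub> u = g' y)"
    if "is_cone (poset_cat S le) C (restrict_functor S le M) c' g'" for c' g'
    using beta_limit[OF M, of a] that by (simp add: is_limit_def S_def)
  ultimately have "\<exists>!u. u \<in> hom C c (Ro M a) \<and> (\<forall>y\<in>S. \<beta> M a y \<cdot>\<^bsub>C\<^esub> u = restrict g S y)"
    by blast
  then show ?thesis
    by (simp add: S_def)
qed

text \<open>Both morphisms factor the cocone obtained by composing \<open>\<alpha> M a\<close> with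
  \<open>v\<close>, so the uniqueness half of the universal property identifies them.\<close>

lemma alpha_joint_epi:
  assumes M: "M \<in> Fun" and u: "u \<in> hom C (Lo M a) c" and v: "v \<in> hom C (Lo M a) c"
    and eq: "\<And>x. (x, a) \<in> far \<Longrightarrow> u \<cdot>\<^bsub>C\<^esub> \<alpha> M a x = v \<cdot>\<^bsub>C\<^esub> \<alpha> M a x"
  shows "u = v"
proof -
  have "\<exists>!w. w \<in> hom C (Lo M a) c \<and> (\<forall>x\<in>down P le \<rho> r a. w \<cdot>\<^bsub>C\<^esub> \<alpha> M a x = v \<cdot>\<^bsub>C\<^esub> \<alpha> M a x)"
  proof (rule Lo_universal[OF M])
    show "c \<in> Obj C"
      using hom_in[OF v] by simp
    show "v \<cdot>\<^bsub>C\<^esub> \<alpha> M a x \<in> hom C (omap M x) c" if "(x, a) \<in> far" for x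
      using comp_in_hom[OF cat alpha_in[OF M that] v] .
    show "(v \<cdot>\<^bsub>C\<^esub> \<alpha> M a y) \<cdot>\<^bsub>C\<^esub> amap M (x, y) = v \<cdot>\<^bsub>C\<^esub> \<alpha> M a x"
      if "(x, y) \<in> le" "(y, a) \<in> far" for x y
      using comp_assoc[OF cat amap_in[OF M that(1)] alpha_in[OF M that(2)] v]
        alpha_comp[OF M that] by simp
  qed
  moreover have "u \<in> hom C (Lo M a) c \<and> (\<forall>x\<in>down P le \<rho> r a. u \<cdot>\<^bsub>C\<^esub> \<alpha> M a x = v \<cdot>\<^bsub>C\<^esub> \<alpha> M a x)"
    using u eq by (simp add: down_iff)
  ultimately show ?thesis
    using v by (elim alt_ex1E) blast
qed

text \<open>Dual to \<open>alpha_joint_epi\<close>. The two together allow equations between maps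
  from a colimit to a limit to be checked one pair \<open>x\<close>, \<open>y\<close> at a
  time.\<close>

lemma beta_joint_mono:
  assumes M: "M \<in> Fun" and u: "u \<in> hom C c (Ro M a)" and v: "v \<in> hom C c (Ro M a)"
    and eq: "\<And>y. (a, y) \<in> far \<Longrightarrow> \<beta> M a y \<cdot>\<^bsub>C\<^esub> u = \<beta> M a y \<cdot>\<^bsub>C\<^esub> v"
  shows "u = v"
proof -
  have "\<exists>!w. w \<in> hom C c (Ro M a) \<and> (\<forall>y\<in>up P le \<rho> r a. \<beta> M a y \<cdot>\<^bsub>C\<^esub> w = \<beta> M a y \<cdot>\<^bsub>C\<^esub> v)"
  proof (rule Ro_universal[OF M])
    show "c \<in> Obj C"
      using hom_in[OF v] by simp
    show "\<beta> M a y \<cdot>\<^bsub>C\<^esub> v \<in> hom C c (omap M y)" if "(a, y) \<in> far" for y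
      using comp_in_hom[OF cat v beta_in[OF M that]] .
    show "amap M (x, y) \<cdot>\<^bsub>C\<^esub> (\<beta> M a x \<cdot>\<^bsub>C\<^esub> v) = \<beta> M a y \<cdot>\<^bsub>C\<^esub> v"
      if "(a, x) \<in> far" "(x, y) \<in> le" for x y
      using comp_assoc[OF cat v beta_in[OF M that(1)] amap_in[OF M that(2)]]
        beta_comp[OF M that] by simp
  qed
  moreover have "u \<in> hom C c (Ro M a) \<and> (\<forall>y\<in>up P le \<rho> r a. \<beta> M a y \<cdot>\<^bsub>C\<^esub> u = \<beta> M a y \<cdot>\<^bsub>C\<^esub> v)"
    using u eq by (simp add: up_iff)
  ultimately show ?thesis
    using v by (elim alt_ex1E) blast
qed

section \<open>Structure maps of \<open>L\<close> and \<open>R\<close>, and the map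
  \<open>e\<close>\<close>

lemma omap_L [simp]: "a \<in> P \<Longrightarrow> omap (L M) a = Lo M a"
  and omap_R [simp]: "a \<in> P \<Longrightarrow> omap (R M) a = Ro M a"
  by (simp_all add: L_fun_def R_fun_def)

text \<open>The \<open>THE\<close> in \<open>L_fun\<close> denotes such a map because the cocone at
  \<open>b\<close>, restricted to the smaller down-set of \<open>a\<close>, is still a
  cocone.\<close>

lemma amap_L:
  assumes M: "M \<in> Fun" and ab: "(a, b) \<in> le"
  shows "amap (L M) (a, b) \<in> hom C (Lo M a) (Lo M b)"
    and "(x, a) \<in> far \<Longrightarrow> amap (L M) (a, b) \<cdot>\<^bsub>C\<^esub> \<alpha> M a x = \<alpha> M b x"
proof -
  have eq: "amap (L M) (a, b) = (THE u. u \<in> hom C (Lo M a) (Lo M b) \<and>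
      (\<forall>x\<in>down P le \<rho> r a. u \<cdot>\<^bsub>C\<^esub> \<alpha> M a x = \<alpha> M b x))"
    using ab le_in[OF ab] by (simp add: L_fun_def)
  have "\<exists>!u. u \<in> hom C (Lo M a) (Lo M b) \<and>
      (\<forall>x\<in>down P le \<rho> r a. u \<cdot>\<^bsub>C\<^esub> \<alpha> M a x = \<alpha> M b x)"
    using alpha_in[OF M] alpha_comp[OF M] far_trans2[OF _ ab]
    by (intro Lo_universal M Lo_in) blast+
  from theI'[OF this] have *: "amap (L M) (a, b) \<in> hom C (Lo M a) (Lo M b) \<and>
      (\<forall>x\<in>down P le \<rho> r a. amap (L M) (a, b) \<cdot>\<^bsub>C\<^esub> \<alpha> M a x = \<alpha> M b x)"
    unfolding eq[symmetric] .
  then show "amap (L M) (a, b) \<in> hom C (Lo M a) (Lo M b)"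
    by blast
  show "(x, a) \<in> far \<Longrightarrow> amap (L M) (a, b) \<cdot>\<^bsub>C\<^esub> \<alpha> M a x = \<alpha> M b x"
    using * by (simp add: down_iff)
qed

lemma amap_R:
  assumes M: "M \<in> Fun" and ab: "(a, b) \<in> le"
  shows "amap (R M) (a, b) \<in> hom C (Ro M a) (Ro M b)"
    and "(b, y) \<in> far \<Longrightarrow> \<beta> M b y \<cdot>\<^bsub>C\<^esub> amap (R M) (a, b) = \<beta> M a y"
proof -
  have eq: "amap (R M) (a, b) = (THE u. u \<in> hom C (Ro M a) (Ro M b) \<and>
      (\<forall>y\<in>up P le \<rho> r b. \<beta> M b y \<cdot>\<^bsub>C\<^esub> u = \<beta> M a y))"
    using ab le_in[OF ab] by (simp add: R_fun_def)
  have "\<exists>!u. u \<in> hom C (Ro M a) (Ro M b) \<and>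
      (\<forall>y\<in>up P le \<rho> r b. \<beta> M b y \<cdot>\<^bsub>C\<^esub> u = \<beta> M a y)"
    using beta_in[OF M] beta_comp[OF M] far_trans1[OF ab]
    by (intro Ro_universal M Ro_in) blast+
  from theI'[OF this] have *: "amap (R M) (a, b) \<in> hom C (Ro M a) (Ro M b) \<and>
      (\<forall>y\<in>up P le \<rho> r b. \<beta> M b y \<cdot>\<^bsub>C\<^esub> amap (R M) (a, b) = \<beta> M a y)"
    unfolding eq[symmetric] .
  then show "amap (R M) (a, b) \<in> hom C (Ro M a) (Ro M b)"
    by blast
  show "(b, y) \<in> far \<Longrightarrow> \<beta> M b y \<cdot>\<^bsub>C\<^esub> amap (R M) (a, b) = \<beta> M a y"
    using * by (simp add: up_iff)
qed

text \<open>By functoriality the structure maps of \<open>M\<close> into \<open>omap M a\<close>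
  form a cocone, so the \<open>THE\<close> in the definition is meaningful.\<close>

lemma eta_L:
  assumes M: "M \<in> Fun" and a: "a \<in> P"
  shows "eta_L P le C \<rho> r M a \<in> hom C (Lo M a) (omap M a)"
    and "(x, a) \<in> far \<Longrightarrow> eta_L P le C \<rho> r M a \<cdot>\<^bsub>C\<^esub> \<alpha> M a x = amap M (x, a)"
proof -
  have "\<exists>!u. u \<in> hom C (Lo M a) (omap M a) \<and>
      (\<forall>x\<in>down P le \<rho> r a. u \<cdot>\<^bsub>C\<^esub> \<alpha> M a x = amap M (x, a))"
    using amap_in[OF M] amap_comp[OF M] far_le
    by (intro Lo_universal M omap_in a) blast+
  from theI'[OF this]
  have *: "eta_L P le C \<rho> r M a \<in> hom C (Lo M a) (omap M a) \<and>
      (\<forall>x\<in>down P le \<rho> r a. eta_L P le C \<rho> r M a \<cdot>\<^bsub>C\<^esub> \<alpha> M a x = amap M (x, a))"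
    using a by (simp add: eta_L_def)
  then show "eta_L P le C \<rho> r M a \<in> hom C (Lo M a) (omap M a)"
    by blast
  show "(x, a) \<in> far \<Longrightarrow> eta_L P le C \<rho> r M a \<cdot>\<^bsub>C\<^esub> \<alpha> M a x = amap M (x, a)"
    using * by (simp add: down_iff)
qed

lemma eta_R:
  assumes M: "M \<in> Fun" and a: "a \<in> P"
  shows "eta_R P le C \<rho> r M a \<in> hom C (omap M a) (Ro M a)"
    and "(a, y) \<in> far \<Longrightarrow> \<beta> M a y \<cdot>\<^bsub>C\<^esub> eta_R P le C \<rho> r M a = amap M (a, y)"
proof -
  have "\<exists>!u. u \<in> hom C (omap M a) (Ro M a) \<and>
      (\<forall>y\<in>up P le \<rho> r a. \<beta> M a y \<cdot>\<^bsub>C\<^esub> u = amap M (a, y))"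
    using amap_in[OF M] amap_comp[OF M] far_le
    by (intro Ro_universal M omap_in a) blast+
  from theI'[OF this]
  have *: "eta_R P le C \<rho> r M a \<in> hom C (omap M a) (Ro M a) \<and>
      (\<forall>y\<in>up P le \<rho> r a. \<beta> M a y \<cdot>\<^bsub>C\<^esub> eta_R P le C \<rho> r M a = amap M (a, y))"
    using a by (simp add: eta_R_def)
  then show "eta_R P le C \<rho> r M a \<in> hom C (omap M a) (Ro M a)"
    by blast
  show "(a, y) \<in> far \<Longrightarrow> \<beta> M a y \<cdot>\<^bsub>C\<^esub> eta_R P le C \<rho> r M a = amap M (a, y)"
    using * by (simp add: up_iff)
qed

text \<open>Reassociation only. A map from a colimit to a limit that factors through
  \<open>c\<close> is tested by \<open>\<alpha>\<close> on one side and \<open>\<beta>\<close> on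
  the other; this splits the test into one part for each factor.\<close>

lemma beta_alpha_comp:
  assumes M: "M \<in> Fun" and N: "N \<in> Fun" and xa: "(x, a) \<in> far" and ay: "(a, y) \<in> far"
    and u: "u \<in> hom C (Lo M a) c" and v: "v \<in> hom C c (Ro N a)"
  shows "\<beta> N a y \<cdot>\<^bsub>C\<^esub> ((v \<cdot>\<^bsub>C\<^esub> u) \<cdot>\<^bsub>C\<^esub> \<alpha> M a x) = (\<beta> N a y \<cdot>\<^bsub>C\<^esub> v) \<cdot>\<^bsub>C\<^esub> (u \<cdot>\<^bsub>C\<^esub> \<alpha> M a x)"
  using comp_assoc[OF cat alpha_in[OF M xa] u v]
    comp_assoc[OF cat comp_in_hom[OF cat alpha_in[OF M xa] u] v beta_in[OF N ay]]
  by simp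

text \<open>Tested between \<open>x\<close> and \<open>y\<close>, the map becomes the structure map
  from \<open>x\<close> to \<open>a\<close> followed by that from \<open>a\<close> to
  \<open>y\<close>.\<close>

lemma e_map:
  assumes M: "M \<in> Fun" and a: "a \<in> P"
  shows "e_map P le C \<rho> r M a \<in> hom C (Lo M a) (Ro M a)"
    and "(x, a) \<in> far \<Longrightarrow> (a, y) \<in> far \<Longrightarrow>
      \<beta> M a y \<cdot>\<^bsub>C\<^esub> (e_map P le C \<rho> r M a \<cdot>\<^bsub>C\<^esub> \<alpha> M a x) = amap M (x, y)"
proof -
  have e: "e_map P le C \<rho> r M a = eta_R P le C \<rho> r M a \<cdot>\<^bsub>C\<^esub> eta_L P le C \<rho> r M a"
    using a by (simp add: e_map_def nt_comp_def)
  show "e_map P le C \<rho> r M a \<in> hom C (Lo M a) (Ro M a)"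
    unfolding e by (rule comp_in_hom[OF cat eta_L(1)[OF M a] eta_R(1)[OF M a]])
  show "\<beta> M a y \<cdot>\<^bsub>C\<^esub> (e_map P le C \<rho> r M a \<cdot>\<^bsub>C\<^esub> \<alpha> M a x) = amap M (x, y)"
    if xa: "(x, a) \<in> far" and ay: "(a, y) \<in> far"
    unfolding e beta_alpha_comp[OF M M xa ay eta_L(1)[OF M a] eta_R(1)[OF M a]]
      eta_L(2)[OF M a xa] eta_R(2)[OF M a ay]
    by (rule amap_comp[OF M far_le[OF xa] far_le[OF ay]])
qed

section \<open>Morphisms into \<open>R\<close> as natural families\<close>

text \<open>Values off \<open>far\<close> are left unconstrained rather than set to
  \<open>undefined\<close>. Therefore a family for one relation is, unchanged, a family for any
  smaller one.\<close>

definition families ::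
    "('p, 'o, 'm) pfunctor \<Rightarrow> ('p, 'o, 'm) pfunctor \<Rightarrow> ('p \<Rightarrow> 'p \<Rightarrow> 'm) set" where
  "families M N = {\<phi>.
     (\<forall>a b. (a, b) \<in> far \<longrightarrow> \<phi> a b \<in> hom C (omap M a) (omap N b)) \<and>
     (\<forall>a b c. (a, b) \<in> le \<longrightarrow> (b, c) \<in> far \<longrightarrow> \<phi> b c \<cdot>\<^bsub>C\<^esub> amap M (a, b) = \<phi> a c) \<and>
     (\<forall>a b c. (a, b) \<in> far \<longrightarrow> (b, c) \<in> le \<longrightarrow> amap N (b, c) \<cdot>\<^bsub>C\<^esub> \<phi> a b = \<phi> a c)}"

lemma familiesD:
  assumes "\<phi> \<in> families M N"
  shows "(a, b) \<in> far \<Longrightarrow> \<phi> a b \<in> hom C (omap M a) (omap N b)"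
    and "(a, b) \<in> le \<Longrightarrow> (b, c) \<in> far \<Longrightarrow> \<phi> b c \<cdot>\<^bsub>C\<^esub> amap M (a, b) = \<phi> a c"
    and "(a, b) \<in> far \<Longrightarrow> (b, c) \<in> le \<Longrightarrow> amap N (b, c) \<cdot>\<^bsub>C\<^esub> \<phi> a b = \<phi> a c"
  using assms by (auto simp: families_def)

text \<open>Naturality in the first variable comes from naturality of \<open>p\<close> and the
  defining equation of the structure maps of \<open>R N\<close>; in the second variable it is the
  cone condition on \<open>\<beta>\<close>.\<close>

lemma families_of_nat_trans:
  assumes M: "M \<in> Fun" and N: "N \<in> Fun" and p: "p \<in> nat_trans (poset_cat P le) C M (R N)"
  shows "(\<lambda>a b. \<beta> N a b \<cdot>\<^bsub>C\<^esub> p a) \<in> families M N"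
proof -
  have p_in: "p a \<in> hom C (omap M a) (Ro N a)" if "a \<in> P" for a
    using natural(1)[OF p that] that by simp
  show ?thesis
    unfolding families_def
  proof (intro CollectI conjI allI impI)
    fix a b assume ab: "(a, b) \<in> far"
    show "\<beta> N a b \<cdot>\<^bsub>C\<^esub> p a \<in> hom C (omap M a) (omap N b)"
      by (rule comp_in_hom[OF cat p_in beta_in[OF N ab]]) (rule far_in[OF ab])
  next
    fix a b c assume ab: "(a, b) \<in> le" and bc: "(b, c) \<in> far"
    have "(\<beta> N b c \<cdot>\<^bsub>C\<^esub> p b) \<cdot>\<^bsub>C\<^esub> amap M (a, b) = \<beta> N b c \<cdot>\<^bsub>C\<^esub> (p b \<cdot>\<^bsub>C\<^esub> amap M (a, b))"
      by (rule comp_assoc[OF cat amap_in[OF M ab] p_in[OF le_in(2)[OF ab]] beta_in[OF N bc]])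
    also have "\<dots> = \<beta> N b c \<cdot>\<^bsub>C\<^esub> (amap (R N) (a, b) \<cdot>\<^bsub>C\<^esub> p a)"
      by (simp add: natural(2)[OF p ab])
    also have "\<dots> = (\<beta> N b c \<cdot>\<^bsub>C\<^esub> amap (R N) (a, b)) \<cdot>\<^bsub>C\<^esub> p a"
      by (rule comp_assoc[OF cat p_in[OF le_in(1)[OF ab]] amap_R(1)[OF N ab] beta_in[OF N bc],
            symmetric])
    also have "\<dots> = \<beta> N a c \<cdot>\<^bsub>C\<^esub> p a"
      by (simp add: amap_R(2)[OF N ab bc])
    finally show "(\<beta> N b c \<cdot>\<^bsub>C\<^esub> p b) \<cdot>\<^bsub>C\<^esub> amap M (a, b) = \<beta> N a c \<cdot>\<^bsub>C\<^esub> p a" .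
  next
    fix a b c assume ab: "(a, b) \<in> far" and bc: "(b, c) \<in> le"
    show "amap N (b, c) \<cdot>\<^bsub>C\<^esub> (\<beta> N a b \<cdot>\<^bsub>C\<^esub> p a) = \<beta> N a c \<cdot>\<^bsub>C\<^esub> p a"
      using comp_assoc[OF cat p_in[OF far_in(1)[OF ab]] beta_in[OF N ab] amap_in[OF N bc]]
        beta_comp[OF N ab bc] by simp
  qed
qed

text \<open>For fixed \<open>a\<close>, the family is a cone in its second variable and so factors
  through \<open>Ro N a\<close>. Naturality in the first variable then makes the factorizations
  natural.\<close>

lemma nat_trans_of_families:
  assumes M: "M \<in> Fun" and N: "N \<in> Fun" and \<phi>: "\<phi> \<in> families M N"
  obtains p where "p \<in> nat_trans (poset_cat P le) C M (R N)"
    and "\<And>a b. (a, b) \<in> far \<Longrightarrow> \<beta> N a b \<cdot>\<^bsub>C\<^esub> p a = \<phi> a b"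
proof -
  have "\<forall>a\<in>P. \<exists>u. u \<in> hom C (omap M a) (Ro N a) \<and> (\<forall>y\<in>up P le \<rho> r a. \<beta> N a y \<cdot>\<^bsub>C\<^esub> u = \<phi> a y)"
  proof
    fix a assume a: "a \<in> P"
    show "\<exists>u. u \<in> hom C (omap M a) (Ro N a) \<and> (\<forall>y\<in>up P le \<rho> r a. \<beta> N a y \<cdot>\<^bsub>C\<^esub> u = \<phi> a y)"
      by (rule ex1_implies_ex, rule Ro_universal[OF N omap_in[OF M a]])
        (use familiesD[OF \<phi>] in blast)+
  qed
  then obtain p where p: "\<And>a. a \<in> P \<Longrightarrow> p a \<in> hom C (omap M a) (Ro N a)"
    and \<beta>p: "\<And>a y. a \<in> P \<Longrightarrow> (a, y) \<in> far \<Longrightarrow> \<beta> N a y \<cdot>\<^bsub>C\<^esub> p a = \<phi> a y"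
    by (metis up_iff)
  \<comment> \<open>Projected to \<open>y\<close>, both sides become \<open>\<phi> a y\<close>; the
    pair \<open>(a, y)\<close> is far by \<open>far_trans1\<close>.\<close>
  have nat: "p b \<cdot>\<^bsub>C\<^esub> amap M (a, b) = amap (R N) (a, b) \<cdot>\<^bsub>C\<^esub> p a" if ab: "(a, b) \<in> le" for a b
  proof (rule beta_joint_mono[OF N])
    note a = le_in(1)[OF ab] and b = le_in(2)[OF ab]
    show "p b \<cdot>\<^bsub>C\<^esub> amap M (a, b) \<in> hom C (omap M a) (Ro N b)"
      by (rule comp_in_hom[OF cat amap_in[OF M ab] p[OF b]])
    show "amap (R N) (a, b) \<cdot>\<^bsub>C\<^esub> p a \<in> hom C (omap M a) (Ro N b)"
      by (rule comp_in_hom[OF cat p[OF a] amap_R(1)[OF N ab]])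
    fix y assume y: "(b, y) \<in> far"
    show "\<beta> N b y \<cdot>\<^bsub>C\<^esub> (p b \<cdot>\<^bsub>C\<^esub> amap M (a, b)) = \<beta> N b y \<cdot>\<^bsub>C\<^esub> (amap (R N) (a, b) \<cdot>\<^bsub>C\<^esub> p a)"
      using comp_assoc[OF cat amap_in[OF M ab] p[OF b] beta_in[OF N y]]
        comp_assoc[OF cat p[OF a] amap_R(1)[OF N ab] beta_in[OF N y]]
        \<beta>p[OF b y] \<beta>p[OF a far_trans1[OF ab y]] familiesD(2)[OF \<phi> ab y] amap_R(2)[OF N ab y]
      by simp
  qed
  show thesis
  proof (rule that)
    show "restrict p P \<in> nat_trans (poset_cat P le) C M (R N)"
      using p nat le_in by (intro nat_transI) auto
    show "\<beta> N a b \<cdot>\<^bsub>C\<^esub> restrict p P a = \<phi> a b" if "(a, b) \<in> far" for a b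
      using \<beta>p[OF _ that] far_in[OF that] by simp
  qed
qed

section \<open>Adjoint morphisms and the interleaving condition\<close>

lemma sharp:
  assumes M: "M \<in> Fun" and N: "N \<in> Fun" and p: "p \<in> nat_trans (poset_cat P le) C M (R N)"
  shows "a \<in> P \<Longrightarrow> sharp P le C \<rho> r M N p a \<in> hom C (Lo M a) (omap N a)"
    and "(x, a) \<in> far \<Longrightarrow> sharp P le C \<rho> r M N p a \<cdot>\<^bsub>C\<^esub> \<alpha> M a x = \<beta> N x a \<cdot>\<^bsub>C\<^esub> p x"
proof -
  define \<phi> where "\<phi> = (\<lambda>a b. \<beta> N a b \<cdot>\<^bsub>C\<^esub> p a)"
  have \<phi>: "\<phi> \<in> families M N"
    using families_of_nat_trans[OF M N p] by (simp add: \<phi>_def)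
  define Q where "Q t \<longleftrightarrow> t \<in> nat_trans (poset_cat P le) C (L M) N \<and>
     (\<forall>a\<in>P. \<forall>x\<in>down P le \<rho> r a. t a \<cdot>\<^bsub>C\<^esub> \<alpha> M a x = \<phi> x a)" for t
  \<comment> \<open>For fixed \<open>a\<close>, the family is a cocone in its first variable, which
    yields the component at \<open>a\<close>. Compatibility in the second variable gives
    naturality.\<close>
  have ex: "\<exists>t. Q t"
  proof -
    have "\<forall>a\<in>P. \<exists>u. u \<in> hom C (Lo M a) (omap N a) \<and>
        (\<forall>x\<in>down P le \<rho> r a. u \<cdot>\<^bsub>C\<^esub> \<alpha> M a x = \<phi> x a)"
    proof
      fix a assume a: "a \<in> P"
      show "\<exists>u. u \<in> hom C (Lo M a) (omap N a) \<and>
          (\<forall>x\<in>down P le \<rho> r a. u \<cdot>\<^bsub>C\<^esub> \<alpha> M a x = \<phi> x a)"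
        by (rule ex1_implies_ex, rule Lo_universal[OF M omap_in[OF N a]])
          (use familiesD[OF \<phi>] in blast)+
    qed
    then obtain t where t: "\<And>a. a \<in> P \<Longrightarrow> t a \<in> hom C (Lo M a) (omap N a)"
      and t\<alpha>: "\<And>a x. a \<in> P \<Longrightarrow> (x, a) \<in> far \<Longrightarrow> t a \<cdot>\<^bsub>C\<^esub> \<alpha> M a x = \<phi> x a"
      by (metis down_iff)
    have nat: "t b \<cdot>\<^bsub>C\<^esub> amap (L M) (a, b) = amap N (a, b) \<cdot>\<^bsub>C\<^esub> t a" if ab: "(a, b) \<in> le" for a b
    proof (rule alpha_joint_epi[OF M])
      note a = le_in(1)[OF ab] and b = le_in(2)[OF ab]
      show "t b \<cdot>\<^bsub>C\<^esub> amap (L M) (a, b) \<in> hom C (Lo M a) (omap N b)"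
        by (rule comp_in_hom[OF cat amap_L(1)[OF M ab] t[OF b]])
      show "amap N (a, b) \<cdot>\<^bsub>C\<^esub> t a \<in> hom C (Lo M a) (omap N b)"
        by (rule comp_in_hom[OF cat t[OF a] amap_in[OF N ab]])
      fix x assume x: "(x, a) \<in> far"
      show "(t b \<cdot>\<^bsub>C\<^esub> amap (L M) (a, b)) \<cdot>\<^bsub>C\<^esub> \<alpha> M a x = (amap N (a, b) \<cdot>\<^bsub>C\<^esub> t a) \<cdot>\<^bsub>C\<^esub> \<alpha> M a x"
        using comp_assoc[OF cat alpha_in[OF M x] amap_L(1)[OF M ab] t[OF b]]
          comp_assoc[OF cat alpha_in[OF M x] t[OF a] amap_in[OF N ab]]
          t\<alpha>[OF a x] t\<alpha>[OF b far_trans2[OF x ab]] familiesD(3)[OF \<phi> x ab] amap_L(2)[OF M ab x]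
        by simp
    qed
    have "restrict t P \<in> nat_trans (poset_cat P le) C (L M) N"
      using t nat le_in by (intro nat_transI) auto
    then have "Q (restrict t P)"
      using t\<alpha> by (simp add: Q_def down_iff)
    then show ?thesis
      by blast
  qed
  \<comment> \<open>The components on \<open>P\<close> are determined by their composites with
    \<open>\<alpha>\<close>, and extensionality fixes the values elsewhere.\<close>
  have unique: "s = t" if "Q s" "Q t" for s t
  proof (rule PiE_ext)
    show "s \<in> (\<Pi>\<^sub>E a\<in>P. hom C (omap (L M) a) (omap N a))"
      "t \<in> (\<Pi>\<^sub>E a\<in>P. hom C (omap (L M) a) (omap N a))"
      using that by (auto simp: Q_def nat_trans_def)
    show "s a = t a" if a: "a \<in> P" for a
    proof (rule alpha_joint_epi[OF M])
      show "s a \<in> hom C (Lo M a) (omap N a)" "t a \<in> hom C (Lo M a) (omap N a)"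
        using \<open>Q s\<close> \<open>Q t\<close> natural(1)[OF _ a, of _ "L M" N] a by (auto simp: Q_def)
      show "s a \<cdot>\<^bsub>C\<^esub> \<alpha> M a x = t a \<cdot>\<^bsub>C\<^esub> \<alpha> M a x" if "(x, a) \<in> far" for x
        using \<open>Q s\<close> \<open>Q t\<close> a that by (simp add: Q_def down_iff)
    qed
  qed
  have "sharp P le C \<rho> r M N p = (THE t. Q t)"
    by (simp add: sharp_def Q_def \<phi>_def)
  moreover have "Q (THE t. Q t)"
    using ex unique by (metis theI)
  ultimately have Q: "Q (sharp P le C \<rho> r M N p)"
    by simp
  show "a \<in> P \<Longrightarrow> sharp P le C \<rho> r M N p a \<in> hom C (Lo M a) (omap N a)"
    using Q natural(1)[of _ "L M" N a] by (simp add: Q_def)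
  show "(x, a) \<in> far \<Longrightarrow> sharp P le C \<rho> r M N p a \<cdot>\<^bsub>C\<^esub> \<alpha> M a x = \<beta> N x a \<cdot>\<^bsub>C\<^esub> p x"
    using Q far_in by (auto simp: Q_def \<phi>_def down_iff)
qed

text \<open>Maps from \<open>Lo M a\<close> to \<open>Ro M a\<close> agree once all their composites
  with \<open>\<alpha>\<close> and \<open>\<beta>\<close> agree. For \<open>e\<close> these
  composites are structure maps of \<open>M\<close>; for the other side they pass through
  \<open>omap N a\<close> and are products of members of the two families.\<close>

lemma e_map_eq_iff:
  assumes M: "M \<in> Fun" and N: "N \<in> Fun"
    and p: "p \<in> nat_trans (poset_cat P le) C M (R N)"
    and q: "q \<in> nat_trans (poset_cat P le) C N (R M)"
  shows "e_map P le C \<rho> r M = nt_comp (poset_cat P le) C q (sharp P le C \<rho> r M N p) \<longleftrightarrow>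
    (\<forall>x a y. (x, a) \<in> far \<longrightarrow> (a, y) \<in> far \<longrightarrow>
      (\<beta> M a y \<cdot>\<^bsub>C\<^esub> q a) \<cdot>\<^bsub>C\<^esub> (\<beta> N x a \<cdot>\<^bsub>C\<^esub> p x) = amap M (x, y))" (is "?e = ?c \<longleftrightarrow> ?rhs")
proof -
  have c: "?c a = q a \<cdot>\<^bsub>C\<^esub> sharp P le C \<rho> r M N p a" if "a \<in> P" for a
    using that by (simp add: nt_comp_def)
  have q_in: "q a \<in> hom C (omap N a) (Ro M a)" if "a \<in> P" for a
    using natural(1)[OF q that] that by simp
  have c_in: "?c a \<in> hom C (Lo M a) (Ro M a)" if "a \<in> P" for a
    unfolding c[OF that] by (rule comp_in_hom[OF cat sharp(1)[OF M N p that] q_in[OF that]])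
  have comp_c: "\<beta> M a y \<cdot>\<^bsub>C\<^esub> (?c a \<cdot>\<^bsub>C\<^esub> \<alpha> M a x) = (\<beta> M a y \<cdot>\<^bsub>C\<^esub> q a) \<cdot>\<^bsub>C\<^esub> (\<beta> N x a \<cdot>\<^bsub>C\<^esub> p x)"
    if xa: "(x, a) \<in> far" and ay: "(a, y) \<in> far" for x a y
  proof -
    have a: "a \<in> P"
      using far_in[OF xa] by simp
    show ?thesis
      unfolding c[OF a] beta_alpha_comp[OF M M xa ay sharp(1)[OF M N p a] q_in[OF a]]
        sharp(2)[OF M N p xa] ..
  qed
  have eq_pointwise: "?e a = ?c a" if a: "a \<in> P" and rhs: ?rhs for a
  proof (rule alpha_joint_epi[OF M e_map(1)[OF M a] c_in[OF a]])
    fix x assume xa: "(x, a) \<in> far"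
    show "?e a \<cdot>\<^bsub>C\<^esub> \<alpha> M a x = ?c a \<cdot>\<^bsub>C\<^esub> \<alpha> M a x"
    proof (rule beta_joint_mono[OF M])
      show "?e a \<cdot>\<^bsub>C\<^esub> \<alpha> M a x \<in> hom C (omap M x) (Ro M a)"
        by (rule comp_in_hom[OF cat alpha_in[OF M xa] e_map(1)[OF M a]])
      show "?c a \<cdot>\<^bsub>C\<^esub> \<alpha> M a x \<in> hom C (omap M x) (Ro M a)"
        by (rule comp_in_hom[OF cat alpha_in[OF M xa] c_in[OF a]])
      show "\<beta> M a y \<cdot>\<^bsub>C\<^esub> (?e a \<cdot>\<^bsub>C\<^esub> \<alpha> M a x) = \<beta> M a y \<cdot>\<^bsub>C\<^esub> (?c a \<cdot>\<^bsub>C\<^esub> \<alpha> M a x)"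
        if ay: "(a, y) \<in> far" for y
        using comp_c[OF xa ay] e_map(2)[OF M a xa ay] rhs xa ay by simp
    qed
  qed
  show ?thesis
  proof
    assume "?e = ?c"
    then show ?rhs
      using comp_c e_map(2)[OF M] far_in by metis
  next
    assume rhs: ?rhs
    show "?e = ?c"
    proof
      \<comment> \<open>Outside \<open>P\<close> both sides are \<open>undefined\<close>, being
        values of \<open>nt_comp\<close>.\<close>
      show "?e a = ?c a" for a
        using eq_pointwise[OF _ rhs] by (cases "a \<in> P") (auto simp: e_map_def nt_comp_def)
    qed
  qed
qed

text \<open>This eliminates the chosen limits and colimits: on the right, \<open>\<rho>\<close> and
  \<open>r\<close> enter only through \<open>far\<close>, so different height-difference functions
  and parameters become comparable.\<close>

lemma height_interleaved_iff:
  assumes M: "M \<in> Fun" and N: "N \<in> Fun"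
  shows "height_interleaved P le C \<rho> r M N \<longleftrightarrow>
    (\<exists>\<phi>\<in>families M N. \<exists>\<psi>\<in>families N M. \<forall>x a y. (x, a) \<in> far \<longrightarrow> (a, y) \<in> far \<longrightarrow>
      \<psi> a y \<cdot>\<^bsub>C\<^esub> \<phi> x a = amap M (x, y) \<and> \<phi> a y \<cdot>\<^bsub>C\<^esub> \<psi> x a = amap N (x, y))"
    (is "_ \<longleftrightarrow> ?rhs")
proof
  assume "height_interleaved P le C \<rho> r M N"
  then obtain p q where p: "p \<in> nat_trans (poset_cat P le) C M (R N)"
    and q: "q \<in> nat_trans (poset_cat P le) C N (R M)"
    and e: "e_map P le C \<rho> r M = nt_comp (poset_cat P le) C q (sharp P le C \<rho> r M N p)"
      "e_map P le C \<rho> r N = nt_comp (poset_cat P le) C p (sharp P le C \<rho> r N M q)"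
    by (auto simp: height_interleaved_def)
  have "\<forall>x a y. (x, a) \<in> far \<longrightarrow> (a, y) \<in> far \<longrightarrow>
      (\<beta> M a y \<cdot>\<^bsub>C\<^esub> q a) \<cdot>\<^bsub>C\<^esub> (\<beta> N x a \<cdot>\<^bsub>C\<^esub> p x) = amap M (x, y) \<and>
      (\<beta> N a y \<cdot>\<^bsub>C\<^esub> p a) \<cdot>\<^bsub>C\<^esub> (\<beta> M x a \<cdot>\<^bsub>C\<^esub> q x) = amap N (x, y)"
    using e e_map_eq_iff[OF M N p q] e_map_eq_iff[OF N M q p] by simp
  then show ?rhs
    using families_of_nat_trans[OF M N p] families_of_nat_trans[OF N M q]
    by (intro bexI) simp_all
next
  assume ?rhs
  then obtain \<phi> \<psi> where \<phi>: "\<phi> \<in> families M N" and \<psi>: "\<psi> \<in> families N M"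
    and inv: "\<And>x a y. (x, a) \<in> far \<Longrightarrow> (a, y) \<in> far \<Longrightarrow>
      \<psi> a y \<cdot>\<^bsub>C\<^esub> \<phi> x a = amap M (x, y) \<and> \<phi> a y \<cdot>\<^bsub>C\<^esub> \<psi> x a = amap N (x, y)"
    by blast
  obtain p where p: "p \<in> nat_trans (poset_cat P le) C M (R N)"
    and \<beta>p: "\<And>a b. (a, b) \<in> far \<Longrightarrow> \<beta> N a b \<cdot>\<^bsub>C\<^esub> p a = \<phi> a b"
    using nat_trans_of_families[OF M N \<phi>] by metis
  obtain q where q: "q \<in> nat_trans (poset_cat P le) C N (R M)"
    and \<beta>q: "\<And>a b. (a, b) \<in> far \<Longrightarrow> \<beta> M a b \<cdot>\<^bsub>C\<^esub> q a = \<psi> a b"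
    using nat_trans_of_families[OF N M \<psi>] by metis
  show "height_interleaved P le C \<rho> r M N"
    unfolding height_interleaved_def
    using p q e_map_eq_iff[OF M N p q] e_map_eq_iff[OF N M q p] \<beta>p \<beta>q inv
    by (intro bexI[OF _ p] bexI[OF _ q]) simp
qed

end

section \<open>Comparison of two height-difference functions\<close>

lemma absdiff_infty_commute: "absdiff_infty a b = absdiff_infty b a"
  by (auto simp: absdiff_infty_def abs_minus_commute)

text \<open>A finite bound forces \<open>a\<close> and \<open>b\<close> to be both finite or both
  infinite, and the two additive inequalities force the same. This form avoids truncated
  subtraction.\<close>

lemma absdiff_infty_le_iff:
  assumes "s \<ge> 0"
  shows "absdiff_infty a b \<le> ennreal s \<longleftrightarrow> a \<le> b + ennreal s \<and> b \<le> a + ennreal s"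
  using assms
  by (cases a; cases b) (auto simp: absdiff_infty_def top_unique simp flip: ennreal_plus)

context poset_functors
begin

lemma height_interleaved_shift:
  assumes \<rho>1: "height_difference P le \<rho>1" and \<rho>2: "height_difference P le \<rho>2"
    and r: "r \<ge> 0" and s: "s \<ge> 0"
    and close: "\<And>a b. (a, b) \<in> le \<Longrightarrow> \<rho>2 a b \<le> \<rho>1 a b + ennreal s"
    and M: "M \<in> Fun" and N: "N \<in> Fun"
    and int: "height_interleaved P le C \<rho>1 r M N"
  shows "height_interleaved P le C \<rho>2 (r + s) M N"
proof -
  interpret A: height_poset_functors P le C \<rho>1 r
    by unfold_locales (rule \<rho>1)
  interpret B: height_poset_functors P le C \<rho>2 "r + s"
    by unfold_locales (rule \<rho>2)
  have far: "(a, b) \<in> A.far" if "(a, b) \<in> B.far" for a b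
  proof -
    have ab: "(a, b) \<in> le" and "ennreal (r + s) \<le> \<rho>2 a b"
      using that by (auto simp: B.far_def)
    \<comment> \<open>As \<open>r\<close> and \<open>s\<close> are nonnegative,
      \<open>ennreal\<close> distributes over their sum. The common summand \<open>ennreal s\<close>
      is finite and is cancelled in the next step.\<close>
    then have "ennreal r + ennreal s \<le> \<rho>1 a b + ennreal s"
      using close[OF ab] r s by (simp add: order_trans)
    then show ?thesis
      using ab by (simp add: A.far_def)
  qed
  then have "A.families M N \<subseteq> B.families M N" for M N
    by (auto simp: A.families_def B.families_def)
  then show ?thesis
    using int far unfolding A.height_interleaved_iff[OF M N] B.height_interleaved_iff[OF M N]
    by (meson subsetD)
qed

lemma height_dist_le:
  assumes "height_difference P le \<rho>1" "height_difference P le \<rho>2" "s \<ge> 0"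
    and "\<And>a b. (a, b) \<in> le \<Longrightarrow> \<rho>2 a b \<le> \<rho>1 a b + ennreal s"
    and "M \<in> Fun" "N \<in> Fun"
  shows "height_dist P le C \<rho>2 M N \<le> height_dist P le C \<rho>1 M N + ennreal s"
proof -
  \<comment> \<open>Moving \<open>s\<close> to the left leaves a bare infimum on the right, to which
    \<open>Inf_greatest\<close> applies. The case without any interleaving for
    \<open>\<rho>1\<close> is covered, since the infimum is then infinite.\<close>
  have "height_dist P le C \<rho>2 M N - ennreal s \<le> height_dist P le C \<rho>1 M N"
    unfolding height_dist_def[of P le C \<rho>1]
  proof (rule Inf_greatest, clarify)
    fix r :: real assume r: "r \<ge> 0" and int: "height_interleaved P le C \<rho>1 r M N"
    have "height_interleaved P le C \<rho>2 (r + s) M N"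
      by (rule height_interleaved_shift[OF assms(1,2) r assms(3-6) int])
    then have "height_dist P le C \<rho>2 M N \<le> ennreal (r + s)"
      unfolding height_dist_def using r assms(3) by (intro Inf_lower CollectI exI[of _ "r + s"]) simp
    then show "height_dist P le C \<rho>2 M N - ennreal s \<le> ennreal r"
      using r assms(3) by (simp add: ennreal_minus_le_iff add.commute)
  qed
  then show ?thesis
    by (simp add: ennreal_minus_le_iff add.commute)
qed

end

section \<open>The Lipschitz estimate for interleaving distances\<close>

theorem theorem1p1:
  fixes P :: "'p set" and le :: "'p rel"
    and C :: "('o, 'm) category"
    and \<rho>1 \<rho>2 :: "'p \<Rightarrow> 'p \<Rightarrow> ennreal"
  assumes "partial_order_on P le"
    and "category C"
    and "complete_category TYPE(('p, 'p \<times> 'p) category) C"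
    and "cocomplete_category TYPE(('p, 'p \<times> 'p) category) C"
    and "height_difference P le \<rho>1"
    and "height_difference P le \<rho>2"
  shows "dist_infty (Functors (poset_cat P le) C) (height_dist P le C \<rho>1) (height_dist P le C \<rho>2)
           \<le> distortion P le \<rho>1 \<rho>2"
proof -
  interpret poset_functors P le C
    using assms(1-4) by unfold_locales
  \<comment> \<open>Every real \<open>s\<close> admissible for the distortion is shown to be
    admissible for \<open>dist_infty\<close>. The infimum over the larger set is the smaller one,
    and attainment of the infimum is not at issue.\<close>
  show ?thesis
    unfolding distortion_def dist_infty_def
  proof (rule Inf_superset_mono, clarify)
    fix s :: real
    assume s: "s \<ge> 0"
      and "\<forall>a\<in>P. \<forall>b\<in>P. (a, b) \<in> le \<longrightarrow> absdiff_infty (\<rho>1 a b) (\<rho>2 a b) \<le> ennreal s"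
    then have "\<rho>1 a b \<le> \<rho>2 a b + ennreal s" "\<rho>2 a b \<le> \<rho>1 a b + ennreal s" if "(a, b) \<in> le" for a b
      using that le_in[OF that] by (auto simp: absdiff_infty_le_iff[OF s])
    \<comment> \<open>The two inequalities come from \<open>height_dist_le\<close> with the roles of
      \<open>\<rho>1\<close> and \<open>\<rho>2\<close> exchanged.\<close>
    then have "absdiff_infty (height_dist P le C \<rho>1 M N) (height_dist P le C \<rho>2 M N) \<le> ennreal s"
      if "M \<in> Fun" "N \<in> Fun" for M N
      using height_dist_le[OF assms(5,6) s _ that] height_dist_le[OF assms(6,5) s _ that]
      by (simp add: absdiff_infty_le_iff[OF s])
    with s show "\<exists>r. ennreal s = ennreal r \<and> 0 \<le> r \<and>
        (\<forall>M\<in>Fun. \<forall>N\<in>Fun.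
          absdiff_infty (height_dist P le C \<rho>1 M N) (height_dist P le C \<rho>2 M N) \<le> ennreal r)"
      by blast
  qed
qed

end
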